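(* Let $(m,i,j)$ be one of the digit-rule data $(3,1,-1)$, $(2,1,0)$, $(2,0,1)$ attached to the billiard tables, and let $d=(d_0,d_1,\dots)\in\{0,\dots,m-1\}^\infty$ be a periodic digit string with $d_0=0$. Then $d$ encodes a rational nonsingular billiard orbit in $\Delta$ if and only if $d$ has a block pattern consisting of two lengths $b,b-1$ (for some integer $b$) and has the property that some nontrivial power of a cyclic permutation applied to the list of block lengths of $d$ differs from that list by an adjacent transposition.
   Context: Tables and labels. The billiard table $\Delta$ is one of the convex polygons that tile $\mathbb{R}^2$ under reflection. Unfolding a billiard trajectory across the edges of $\Delta$ turns it into a ray $\tau$ in the edge-labelled tessellation of $\mathbb{R}^2$ by reflected copies of $\Delta$, and the sequence of bounces is the sequence of labels of the edges met by $\tau$. After deletion of certain families of edges, the remaining labelled edges form the following general scheme. There are linearly independent vectors $v_1,v_2\in\mathbb{R}^2$ generating the vertex lattice, and the remaining labels are digits modulo $m$. Moving from one edge to the next by a unit step in $v_1$ adds $j$ to the digit modulo $m$, and moving by a unit step in $v_2$ adds $i$ modulo $m$. The data are: equilateral triangle ($A_2$): $m=3$, $i=1$, $j=-1$; $45$-$45$-$90$ triangle ($B_2$): $m=2$, $i=1$, $j=0$; square ($D_2$): $m=2$, $i=0$, $j=1$; the $30$-$60$-$90$ triangle ($G_2$) is reduced to the $D_2$ data by a linear map. Encoding. A string $d$ with $d_0=0$ encodes a rational nonsingular billiard orbit if there are coprime integers $0<q<n$ and a real $0<a<1$ such that the ray $\tau=\{p_0+tv_0:t\ge0\}$, with $p_0=av_1+(1-a)v_2$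 and $v_0=n^{-1}(qv_1+(n-q)v_2)$, passes through no point of the lattice $\mathbb{Z}v_1+\mathbb{Z}v_2$ (nonsingular) and $d$ is its digit string: $d_k\equiv jX_k+i(k-X_k)\pmod m$ with $X_k=\lfloor a+kq/n\rfloor$, for all $k\ge0$. This $d_k$ is the label of the edge containing $p_0+kv_0$. Blocks. The increments $d_k-d_{k-1}$ of $d$ are each required to be $i$ or $j$ modulo $m$. A block of $d$ is a maximal run of consecutive digits in which each digit after the first is the preceding digit plus $i$ modulo $m$. Consecutive blocks are separated by an increment $+j$. The length of a block is its number of digits. The list of block lengths is the list of lengths of the blocks in one minimal period of the sequence of increments, read cyclically; adjacency in this list is cyclic adjacency. The cyclic permutation is the cyclic shift of this list.
   Formalization: For orbits with a single block per period (q = 1) the literal claim fails; here the list [b] with b ≥ 2 also counts as a block pattern with lengths b, b-1 (b-1 need not occur) and as having the shift/adjacent-transposition property. *)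

theory Defs
  imports "HOL-Analysis.Analysis" "HOL-Number_Theory.Cong" "HOL-Combinatorics.Permutations"
begin

section \<open>Encoding of rational nonsingular orbits\<close>

definition vertex_lattice :: "real^2 \<Rightarrow> real^2 \<Rightarrow> (real^2) set" where
  "vertex_lattice v1 v2 = {of_int x *\<^sub>R v1 + of_int y *\<^sub>R v2 | x y :: int. True}"

definition ray :: "real^2 \<Rightarrow> real^2 \<Rightarrow> (real^2) set" where
  "ray p v = {p + t *\<^sub>R v | t :: real. 0 \<le> t}"

definition start_point :: "real^2 \<Rightarrow> real^2 \<Rightarrow> real \<Rightarrow> real^2" where
  "start_point v1 v2 a = a *\<^sub>R v1 + (1 - a) *\<^sub>R v2"

definition direction :: "real^2 \<Rightarrow> real^2 \<Rightarrow> nat \<Rightarrow> nat \<Rightarrow> real^2" where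
  "direction v1 v2 q n = (1 / real n) *\<^sub>R (real q *\<^sub>R v1 + (real n - real q) *\<^sub>R v2)"

definition crossing :: "real \<Rightarrow> nat \<Rightarrow> nat \<Rightarrow> nat \<Rightarrow> int" where
  "crossing a q n k = \<lfloor>a + real k * real q / real n\<rfloor>"

text \<open>With \<open>X = crossing a q n k\<close>, the edge met at time \<open>k\<close> is the translate by
  \<open>X v1 + (k - X) v2\<close> of the edge from \<open>v2\<close> to \<open>v1\<close>.  That edge has label \<open>0\<close>, and each
  step by \<open>v1\<close> adds \<open>j\<close>, each step by \<open>v2\<close> adds \<open>i\<close>; this gives the label
  \<open>j X + i (k - X)\<close> used in \<open>encodes_orbit\<close>.\<close>

lemma start_point_direction_on_edge:
  fixes v1 v2 :: "real^2" and a :: real and q n k :: nat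
  assumes "0 < n"
  defines "X \<equiv> crossing a q n k"
  defines "c \<equiv> of_int X *\<^sub>R v1 + of_int (int k - X) *\<^sub>R v2"
  shows "start_point v1 v2 a + real k *\<^sub>R direction v1 v2 q n
           \<in> closed_segment (c + v2) (c + v1)"
proof -
  define u where "u = frac (a + real k * real q / real n)"
  have u: "0 \<le> u" "u \<le> 1"
    using frac_lt_1[of "a + real k * real q / real n"] by (auto simp: u_def)
  have X: "of_int X = a + real k * real q / real n - u"
    by (simp add: X_def crossing_def u_def frac_def)
  have n: "real n \<noteq> 0" using assms(1) by simp
  have "start_point v1 v2 a + real k *\<^sub>R direction v1 v2 q n
          = (1 - u) *\<^sub>R (c + v2) + u *\<^sub>R (c + v1)"
    unfolding vec_eq_iff start_point_def direction_def c_def using n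
    by (simp add: X field_simps)
  then show ?thesis using u by (auto simp: in_segment)
qed

definition encodes_orbit ::
  "real^2 \<Rightarrow> real^2 \<Rightarrow> int \<Rightarrow> int \<Rightarrow> int \<Rightarrow> (nat \<Rightarrow> int) \<Rightarrow> bool" where
  "encodes_orbit v1 v2 m i j d \<longleftrightarrow>
     (\<exists>(q::nat) (n::nat) (a::real).
        0 < q \<and> q < n \<and> coprime q n \<and> 0 < a \<and> a < 1 \<and>
        ray (start_point v1 v2 a) (direction v1 v2 q n) \<inter> vertex_lattice v1 v2 = {} \<and>
        (\<forall>k. [d k = j * crossing a q n k + i * (int k - crossing a q n k)] (mod m)))"

section \<open>Blocks\<close>

definition periodic :: "(nat \<Rightarrow> 'a) \<Rightarrow> bool" where
  "periodic f \<longleftrightarrow> (\<exists>P>0. \<forall>k. f (k + P) = f k)"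

definition increment :: "int \<Rightarrow> (nat \<Rightarrow> int) \<Rightarrow> nat \<Rightarrow> int" where
  "increment m d k = (d (Suc k) - d k) mod m"

definition admissible_increments :: "int \<Rightarrow> int \<Rightarrow> int \<Rightarrow> (nat \<Rightarrow> int) \<Rightarrow> bool" where
  "admissible_increments m i j d \<longleftrightarrow>
     (\<forall>k. [increment m d k = i] (mod m) \<or> [increment m d k = j] (mod m))"

definition increment_period :: "int \<Rightarrow> (nat \<Rightarrow> int) \<Rightarrow> nat" where
  "increment_period m d = (LEAST N. 0 < N \<and> (\<forall>k. increment m d (k + N) = increment m d k))"

text \<open>\<open>is_block m i d s l\<close>: the \<open>l\<close> digits \<open>d s, \<dots>, d (s + l - 1)\<close> form a maximal run in which
  each digit after the first is the preceding one plus \<open>i\<close>.  Position \<open>0\<close> is not counted as a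
  start, since for a block pattern read cyclically the run containing \<open>d 0\<close> may begin earlier;
  that run reappears one period later.\<close>

definition is_block :: "int \<Rightarrow> int \<Rightarrow> (nat \<Rightarrow> int) \<Rightarrow> nat \<Rightarrow> nat \<Rightarrow> bool" where
  "is_block m i d s l \<longleftrightarrow>
     0 < s \<and> 0 < l \<and>
     (\<forall>k. s < k \<and> k < s + l \<longrightarrow> [d k = d (k - 1) + i] (mod m)) \<and>
     \<not> [d s = d (s - 1) + i] (mod m) \<and>
     \<not> [d (s + l) = d (s + l - 1) + i] (mod m)"

text \<open>The starts \<open>1, \<dots>, N\<close> correspond to the increments \<open>0, \<dots>, N - 1\<close>, so each block of one
  minimal period \<open>N\<close> is listed exactly once.  If every increment is \<open>i\<close>, there is
  no (finite) block and the list is empty.\<close>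

definition block_lengths :: "int \<Rightarrow> int \<Rightarrow> (nat \<Rightarrow> int) \<Rightarrow> nat list" where
  "block_lengths m i d =
     map (\<lambda>s. THE l. is_block m i d s l)
       (sorted_list_of_set {s \<in> {1..increment_period m d}. \<exists>l. is_block m i d s l})"

text \<open>Both \<open>b\<close> and \<open>b - 1\<close> are positive lengths and every block has one of them; \<open>b\<close> is the
  larger length that occurs.  That \<open>b - 1\<close> occurs as well is not demanded here: it follows from
  \<open>shift_is_adjacent_transposition\<close> as soon as there are at least two blocks, and an orbit with
  \<open>q = 1\<close> has the single block length \<open>n\<close>.\<close>

definition two_length_block_pattern :: "int \<Rightarrow> int \<Rightarrow> int \<Rightarrow> (nat \<Rightarrow> int) \<Rightarrow> bool" where
  "two_length_block_pattern m i j d \<longleftrightarrow>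
     admissible_increments m i j d \<and>
     (\<exists>b::nat. 2 \<le> b \<and> b \<in> set (block_lengths m i d) \<and>
        set (block_lengths m i d) \<subseteq> {b, b - 1})"

text \<open>The exponent \<open>r\<close> of the cyclic shift is nontrivial modulo the number of blocks.  A list of
  one block (the case \<open>q = 1\<close>) needs a convention, as all powers of the shift are the identity
  there: \<open>r > 0\<close> suffices, and the entry is cyclically adjacent to itself, so the property holds.
  For two or more blocks the list of one minimal period is not invariant under any shift
  by \<open>0 < r < length xs\<close>, so the exchanged entries are automatically distinct.\<close>

definition shift_is_adjacent_transposition :: "'a list \<Rightarrow> bool" where
  "shift_is_adjacent_transposition xs \<longleftrightarrow>
     (\<exists>r p. 0 < r \<and> (length xs \<noteq> 1 \<longrightarrow> r < length xs) \<and> p < length xs \<and>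
        rotate r xs = permute_list (Transposition.transpose p (Suc p mod length xs)) xs)"

end

theory Submission
  imports Defs
begin

text \<open>
  Call a position \<open>k\<close> a break of \<open>d\<close> if the increment from \<open>d k\<close> to \<open>d (k + 1)\<close> is not \<open>i\<close>.  The block
  lengths are the gaps between consecutive breaks.  Since \<open>i\<close> and \<open>j\<close> differ modulo \<open>m\<close> and
  \<open>d 0 = 0\<close>, an admissible string is determined by its set \<open>S\<close> of breaks, so that both sides of
  the equivalence turn into properties of \<open>S\<close>.

  The crossing number \<open>\<lfloor>a + k q / n\<rfloor>\<close> of an orbit jumps at the times \<open>(n x + e) div q\<close>, where
  \<open>x = 0, 1, \<dots>\<close> and \<open>e = n - 1 - \<lfloor>n a\<rfloor>\<close>.  So \<open>d\<close> encodes an orbit if and only if it is admissible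
  and \<open>S\<close> is enumerated by such a floor sequence (\<open>encodes_orbit_iff_breaks_floor_form\<close>).  In that
  case \<open>n\<close> is the minimal period of the increments and \<open>q\<close> the number of blocks per period.

  It remains to recognise floor sequences by their gaps (\<open>floor_form_iff_block_pattern\<close>).  Write
  \<open>n = B q + s\<close> with \<open>0 \<le> s < q\<close>.  The gaps are \<open>B\<close> or \<open>B + 1\<close>, and the longer ones are the places \<open>x\<close> at which
  \<open>s x + c\<close> modulo \<open>q\<close> falls into the arc \<open>{0..<s}\<close>.  This is the coding of a rotation, and for
  codings of rotations with two or more gaps the transposition property is an instance of a classical
  characterisation of Christoffel words: shifting \<open>x\<close> by the inverse \<open>r\<close> of \<open>s\<close> moves the
  coded point by one unit, which changes membership in the arc only at its two ends, and these
  belong to adjacent places (\<open>rotation_coding_swap\<close>).  Conversely, if a shift by \<open>r\<close> acts on a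
  primitive cyclic list as the transposition of the places \<open>p\<close> and \<open>p + 1\<close>, then along the orbit of
  \<open>p\<close> under the shift the entries stay constant except where it passes \<open>p\<close> and \<open>p + 1\<close>.  Hence the orbit consists of
  two runs, and as it must pass through \<open>p + 1\<close>, the number \<open>r\<close> is invertible modulo \<open>q\<close>
  and the list is the coding of a rotation (\<open>swap_imp_rotation_coding\<close>).  The list of block
  lengths is primitive because it belongs to a minimal period (\<open>gap_primitive\<close>).  A single block is
  the case \<open>q = 1\<close> and is treated directly.
\<close>

section \<open>Carries and rotations modulo q\<close>

text \<open>
  Adding \<open>s < q\<close> produces a carry exactly when the new remainder has wrapped around below \<open>s\<close>.
  So the steps of a sequence of floors with slope \<open>s / q\<close> are read off from a rotation of
  \<open>\<int>/q\<close>: they are larger by one precisely on the preimage of the arc \<open>{0..<s}\<close>.  Every passage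
  below between floors and rotation codings goes through this lemma.
\<close>

lemma div_add_carry:
  fixes u B s q :: int
  assumes "0 \<le> s" "s < q"
  shows "(u + (B * q + s)) div q = u div q + B + of_bool ((u + s) mod q < s)"
proof -
  define t where "t = u div q"
  define \<rho> where "\<rho> = u mod q"
  have q: "q > 0" using assms by simp
  have u: "u = t * q + \<rho>" and \<rho>: "0 \<le> \<rho>" "\<rho> < q"
    using q by (simp_all add: t_def \<rho>_def)
  show ?thesis
  proof (cases "\<rho> + s < q")
    case True
    have "(u + (B * q + s)) div q = t + B" "(u + s) mod q = \<rho> + s"
      using True assms \<rho> by (auto simp: u algebra_simps intro!: int_div_pos_eq int_mod_pos_eq)
    then show ?thesis using \<rho> by (simp add: t_def)
  next
    case False
    have "(u + (B * q + s)) div q = t + B + 1"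
      by (rule int_div_pos_eq[where r = "\<rho> + s - q"]) (use False assms \<rho> in \<open>auto simp: u algebra_simps\<close>)
    moreover have "(u + s) mod q = \<rho> + s - q"
      by (rule int_mod_pos_eq[where q = "t + 1"]) (use False assms \<rho> in \<open>auto simp: u algebra_simps\<close>)
    ultimately show ?thesis using \<rho> by (simp add: t_def)
  qed
qed

text \<open>
  A rotation coding is the indicator of the arc \<open>{0..<s}\<close> along \<open>x \<mapsto> s x + c\<close>.  Translating \<open>x\<close> by
  the inverse \<open>r\<close> of \<open>s\<close> moves the point of \<open>\<int>/q\<close> by one unit only, so membership in the arc
  changes just at the two points \<open>q - 1\<close> (which enters) and \<open>s - 1\<close> (which leaves).  These differ
  by \<open>s\<close>, hence belong to neighbouring places \<open>p\<close> and \<open>p + 1\<close>: translation by \<open>r\<close> is an adjacent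
  transposition.
\<close>

lemma rotation_coding_swap:
  fixes s c q r p x :: int
  assumes "0 < s" "s < q" and r: "[s * r = 1] (mod q)" and p: "[s * p + c = -1] (mod q)"
  defines "low \<equiv> \<lambda>x. (s * x + c) mod q < s"
  shows "low (x + r) = low (if [x = p] (mod q) then p + 1 else if [x = p + 1] (mod q) then p else x)"
proof -
  define v where "v = (s * x + c) mod q"
  have v: "0 \<le> v" "v < q" using assms(1,2) by (simp_all add: v_def)
  have shift: "(s * (x + r) + c) mod q = (v + 1) mod q"
  proof -
    have "[s * (x + r) + c = (s * x + c) + s * r] (mod q)" by (simp add: algebra_simps)
    also have "[(s * x + c) + s * r = v + 1] (mod q)"
      using r by (intro cong_add) (simp_all add: v_def cong_def)
    finally show ?thesis by (simp add: cong_def)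
  qed
  have at_p: "(s * p + c) mod q = q - 1"
    using p assms(1,2) by (simp add: cong_def zmod_minus1)
  have at_p1: "(s * (p + 1) + c) mod q = s - 1"
  proof -
    have "[s * (p + 1) + c = (s * p + c) + s] (mod q)" by (simp add: algebra_simps)
    also have "[(s * p + c) + s = -1 + s] (mod q)" using p by (intro cong_add) simp_all
    finally show ?thesis using assms(1,2) by (simp add: cong_def)
  qed
  have inj: "[x = y] (mod q)" if "[s * x + c = s * y + c] (mod q)" for x y
  proof -
    have "[x = r * (s * x)] (mod q)" for x
      using cong_scalar_right[OF r, of x] by (simp add: cong_sym ac_simps)
    moreover have "[r * (s * x) = r * (s * y)] (mod q)"
      by (rule cong_scalar_left) (use that in \<open>simp add: cong_add_rcancel\<close>)
    ultimately show ?thesis by (meson cong_sym cong_trans)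
  qed
  consider "[x = p] (mod q)" | "\<not> [x = p] (mod q)" "[x = p + 1] (mod q)"
    | "\<not> [x = p] (mod q)" "\<not> [x = p + 1] (mod q)" by blast
  then show ?thesis
  proof cases
    case 1
    then have "[s * x + c = s * p + c] (mod q)" by (intro cong_add cong_scalar_left) simp_all
    then have "v = q - 1" using at_p by (simp add: v_def cong_def)
    then show ?thesis using 1 at_p1 shift assms(1,2) by (simp add: low_def)
  next
    case 2
    then have "[s * x + c = s * (p + 1) + c] (mod q)" by (intro cong_add cong_scalar_left) simp_all
    then have "v = s - 1" using at_p1 by (simp add: v_def cong_def)
    then show ?thesis using 2 at_p shift assms(1,2) by (simp add: low_def)
  next
    case 3
    then have "v \<noteq> q - 1" "v \<noteq> s - 1"
      using inj[of x p] inj[of x "p + 1"] at_p at_p1 by (auto simp: v_def cong_def)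
    then show ?thesis using 3 shift v by (auto simp: low_def v_def[symmetric])
  qed
qed

text \<open>
  Conversely, follow the orbit of \<open>p\<close> under translation by \<open>r\<close>.  Along it, \<open>G\<close> is constant except
  at the steps leaving \<open>p\<close> and \<open>p + 1\<close>, where it takes the value of the other place.  If the orbit
  returned to \<open>p\<close> without meeting \<open>p + 1\<close>, then \<open>G\<close> would keep the value \<open>G (p + 1)\<close> all the way
  back to \<open>p\<close>, which contradicts \<open>G p \<noteq> G (p + 1)\<close>.  So \<open>p + 1\<close> is reached, say after \<open>s\<close> steps;
  this makes \<open>r\<close> invertible with inverse \<open>s\<close>, and the orbit visits every residue.  The value is
  \<open>G (p + 1)\<close> during the first \<open>s\<close> steps and \<open>G p\<close> during the remaining \<open>q - s\<close>, which is a
  rotation coding.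
\<close>

lemma swap_imp_rotation_coding:
  fixes G :: "int \<Rightarrow> 'a" and q r p :: int
  assumes q: "1 < q"
    and per: "\<And>x y. [x = y] (mod q) \<Longrightarrow> G x = G y"
    and swap: "\<And>x. G (x + r) = G (if [x = p] (mod q) then p + 1
                                  else if [x = p + 1] (mod q) then p else x)"
    and ne: "G p \<noteq> G (p + 1)"
  shows "\<exists>s. 0 < s \<and> s < q \<and> [s * r = 1] (mod q) \<and>
           (\<forall>x. G x = (if (s * (x - p) - 1) mod q < s then G (p + 1) else G p))"
proof -
  define H where "H t = G (p + int t * r)" for t :: nat
  have H1: "H (Suc 0) = G (p + 1)"
    using swap[of p] by (simp add: H_def)
  have Hstep: "H (Suc t) = H t"
    if "\<not> [int t * r = 0] (mod q)" "\<not> [int t * r = 1] (mod q)" for t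
  proof -
    have "\<not> [p + int t * r = p] (mod q)"
      using that(1) cong_add_lcancel_0[of p "int t * r" q] by simp
    moreover have "\<not> [p + int t * r = p + 1] (mod q)"
      using that(2) cong_add_lcancel[of p "int t * r" 1 q] by simp
    ultimately show ?thesis
      using swap[of "p + int t * r"] by (simp add: H_def algebra_simps)
  qed
  have "\<exists>t. [int t * r = 1] (mod q)"
  proof (rule ccontr)
    assume no: "\<not> ?thesis"
    define T where "T = (LEAST t. 0 < t \<and> [int t * r = 0] (mod q))"
    have "0 < nat q \<and> [int (nat q) * r = 0] (mod q)"
      using q by (simp add: cong_mult_self_left)
    then have T: "0 < T" "[int T * r = 0] (mod q)"
      unfolding T_def by (metis (mono_tags, lifting) LeastI)+
    have least: "\<not> [int t * r = 0] (mod q)" if "0 < t" "t < T" for t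
      using not_less_Least[of t "\<lambda>t. 0 < t \<and> [int t * r = 0] (mod q)"] that
      by (auto simp: T_def)
    have "H t = G (p + 1)" if "0 < t" "t \<le> T" for t
      using that
    proof (induction t)
      case (Suc t)
      show ?case
      proof (cases "t = 0")
        case True then show ?thesis using H1 by simp
      next
        case False
        then have "H (Suc t) = H t" using least[of t] no Suc.prems by (intro Hstep) auto
        then show ?thesis using Suc False by simp
      qed
    qed simp
    then have "H T = G (p + 1)" using T by simp
    moreover have "H T = G p"
      unfolding H_def by (rule per) (use T(2) cong_add_lcancel_0[of p "int T * r" q] in simp)
    ultimately show False using ne by simp
  qed
  then obtain t where t: "[int t * r = 1] (mod q)" by blast
  define s where "s = int t mod q"
  have sr: "[s * r = 1] (mod q)"
    using t by (simp add: s_def cong_def mod_mult_left_eq)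
  have s: "0 < s" "s < q"
  proof -
    have "s \<noteq> 0" using sr q by (auto simp: cong_def)
    then show "0 < s" "s < q" using q pos_mod_bound[of q "int t"] pos_mod_sign[of q "int t"]
      by (auto simp: s_def simp del: pos_mod_bound pos_mod_sign)
  qed
  have coset: "[t' * r = y] (mod q) \<longleftrightarrow> [t' = s * y] (mod q)" for t' y
  proof
    assume "[t' * r = y] (mod q)"
    then have "[s * (t' * r) = s * y] (mod q)" by (rule cong_scalar_left)
    moreover have "[s * (t' * r) = t'] (mod q)"
      using cong_scalar_right[OF sr, of t'] by (simp add: ac_simps)
    ultimately show "[t' = s * y] (mod q)" by (meson cong_sym cong_trans)
  next
    assume "[t' = s * y] (mod q)"
    then have "[t' * r = (s * y) * r] (mod q)" by (rule cong_scalar_right)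
    moreover have "[(s * y) * r = y] (mod q)"
      using cong_scalar_right[OF sr, of y] by (simp add: ac_simps)
    ultimately show "[t' * r = y] (mod q)" by (meson cong_trans)
  qed
  have H: "H t = (if int t \<le> s then G (p + 1) else G p)" if "0 < t" "int t \<le> q" for t
    using that
  proof (induction t)
    case (Suc t)
    show ?case
    proof (cases "t = 0")
      case True then show ?thesis using H1 s by simp
    next
      case False
      then have t: "0 < int t" "int t < q" using Suc.prems by auto
      have IH: "H t = (if int t \<le> s then G (p + 1) else G p)" using Suc t by simp
      have nz: "\<not> [int t * r = 0] (mod q)"
        unfolding coset using t by (simp add: cong_def)
      show ?thesis
      proof (cases "int t = s")
        case True
        have "H (Suc t) = G ((p + int t * r) + r)" by (simp add: H_def algebra_simps)
        also have "\<dots> = G p"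
        proof -
          have "[p + int t * r = p + 1] (mod q)" using sr True by (simp add: cong_add_lcancel)
          moreover have "\<not> [p + int t * r = p] (mod q)"
            using nz cong_add_lcancel_0[of p "int t * r" q] by simp
          ultimately show ?thesis using swap[of "p + int t * r"] by simp
        qed
        finally show ?thesis using True by simp
      next
        case neq: False
        have "\<not> [int t * r = 1] (mod q)"
          unfolding coset using neq t s by (simp add: cong_def)
        then have "H (Suc t) = H t" using nz by (intro Hstep)
        then show ?thesis using IH neq by auto
      qed
    qed
  qed simp
  have "G x = (if (s * (x - p) - 1) mod q < s then G (p + 1) else G p)" for x
  proof -
    \<comment> \<open>\<open>x\<close> is reached from \<open>p\<close> after \<open>w + 1 \<in> {1..q}\<close> steps; counting from \<open>1\<close> puts \<open>p\<close> itself at the end\<close>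
    define w where "w = (s * (x - p) - 1) mod q"
    have w: "0 \<le> w" "w < q" using q by (simp_all add: w_def)
    have "[w + 1 = s * (x - p)] (mod q)"
      using cong_add[of w "s * (x - p) - 1" q 1 1] by (simp add: w_def cong_def)
    then have "[(w + 1) * r = x - p] (mod q)" unfolding coset .
    then have "[p + (w + 1) * r = p + (x - p)] (mod q)" by (intro cong_add) simp_all
    then have "G x = G (p + (w + 1) * r)" by (intro per) (simp add: cong_sym)
    also have "\<dots> = H (nat (w + 1))" using w by (simp add: H_def)
    also have "\<dots> = (if w + 1 \<le> s then G (p + 1) else G p)" using w by (subst H) auto
    finally show ?thesis by (simp add: w_def)
  qed
  then show ?thesis using s sr by blast
qed

section \<open>Enumerating sets and lists of gaps\<close>

lemma card_below_enumerate:
  fixes S :: "nat set"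
  assumes "infinite S"
  shows "card (S \<inter> {..<enumerate S x}) = x"
proof -
  have "S \<inter> {..<enumerate S x} = enumerate S ` {..<x}"
  proof (intro set_eqI iffI)
    fix k assume k: "k \<in> S \<inter> {..<enumerate S x}"
    then obtain y where "enumerate S y = k" using enumerate_Ex[of S k] assms by auto
    then show "k \<in> enumerate S ` {..<x}" using k assms by auto
  qed (use assms enumerate_in_set[OF assms] in auto)
  moreover have "inj_on (enumerate S) {..<x}"
    using inj_enumerate[OF assms] by (rule inj_on_subset) simp
  ultimately show ?thesis by (simp add: card_image)
qed

lemma enumerate_card_below:
  fixes S :: "nat set"
  assumes "infinite S" "k \<in> S"
  shows "enumerate S (card (S \<inter> {..<k})) = k"
  using assms card_below_enumerate enumerate_Ex[of S k] by metis

lemma enumerate_range_strict_mono: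
  fixes f :: "nat \<Rightarrow> nat"
  assumes "strict_mono f"
  shows "enumerate (range f) x = f x"
proof -
  have inf: "infinite (range f)"
    using assms by (simp add: range_inj_infinite strict_mono_imp_inj_on)
  have "range f \<inter> {..<f x} = f ` {..<x}"
    using strict_mono_less[OF assms] by auto
  then have "card (range f \<inter> {..<f x}) = x"
    using assms by (simp add: card_image strict_mono_imp_inj_on inj_on_subset)
  then show ?thesis using enumerate_card_below[OF inf, of "f x"] by simp
qed

lemma shift_is_adjacent_transposition_map_upt:
  assumes "2 \<le> q"
  shows "shift_is_adjacent_transposition (map g [0..<q]) \<longleftrightarrow>
    (\<exists>r p. 0 < r \<and> r < q \<and> p < q \<and>
       (\<forall>x<q. g ((x + r) mod q) = g (Transposition.transpose p (Suc p mod q) x)))"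
proof -
  have *: "rotate r (map g [0..<q]) = permute_list (Transposition.transpose p (Suc p mod q)) (map g [0..<q])
    \<longleftrightarrow> (\<forall>x<q. g ((x + r) mod q) = g (Transposition.transpose p (Suc p mod q) x))"
    if "p < q" for r p
  proof -
    have bound: "Transposition.transpose p (Suc p mod q) x < q" if "x < q" for x
      using \<open>p < q\<close> that by (auto simp: Transposition.transpose_def)
    show ?thesis
      unfolding list_eq_iff_nth_eq permute_list_def
      using bound assms by (auto simp: nth_rotate add.commute)
  qed
  then show ?thesis
    unfolding shift_is_adjacent_transposition_def length_map length_upt
    using assms by (intro ex_cong1) (auto simp: *)
qed

text \<open>
  The set \<open>S\<close> stands for the positions of the block boundaries, \<open>N\<close> for the minimal period of the
  increments.  Then \<open>q\<close> is the number of blocks in one period, and \<open>gap 0, \<dots>, gap (q - 1)\<close> are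
  the block lengths; the function \<open>gap\<close> continues this list periodically.
\<close>

locale primitive_periodic_set =
  fixes S :: "nat set" and N :: nat
  assumes N_pos: "0 < N"
    and periodic: "k + N \<in> S \<longleftrightarrow> k \<in> S"
    and minimal: "0 < M \<Longrightarrow> (\<And>k. k + M \<in> S \<longleftrightarrow> k \<in> S) \<Longrightarrow> N \<le> M"
    and nonempty: "S \<noteq> {}"
begin

definition q :: nat where "q = card (S \<inter> {..<N})"

definition gap :: "nat \<Rightarrow> nat" where "gap x = enumerate S (Suc x) - enumerate S x"

lemma periodic_mult: "k + M * N \<in> S \<longleftrightarrow> k \<in> S"
proof (induction M)
  case (Suc M)
  then show ?case using periodic[of "k + M * N"] by (simp add: algebra_simps)
qed simp

lemma infinite_S: "infinite S"
proof -
  obtain k where k: "k \<in> S" using nonempty by blast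
  show ?thesis
    unfolding infinite_nat_iff_unbounded_le
  proof
    fix m
    show "\<exists>n\<ge>m. n \<in> S"
      using k N_pos periodic_mult[of k m] by (intro exI[of _ "k + m * N"]) (simp add: trans_le_add2)
  qed
qed

lemma enumerate_less: "enumerate S x < enumerate S (Suc x)"
  using enumerate_step[OF infinite_S] .

lemma enumerate_Suc_gap: "enumerate S (Suc x) = enumerate S x + gap x"
  using enumerate_less[of x] by (simp add: gap_def)

lemma card_below_shift: "card (S \<inter> {..<k + N}) = card (S \<inter> {..<k}) + q"
proof -
  have "S \<inter> {..<k + N} = S \<inter> {..<N} \<union> (\<lambda>x. x + N) ` (S \<inter> {..<k})"
  proof (intro set_eqI iffI)
    fix x assume x: "x \<in> S \<inter> {..<k + N}"
    show "x \<in> S \<inter> {..<N} \<union> (\<lambda>x. x + N) ` (S \<inter> {..<k})"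
    proof (cases "x < N")
      case False
      then have "x = (x - N) + N" by simp
      then show ?thesis using x periodic[of "x - N"] False
        by (intro UnI2 image_eqI[of _ _ "x - N"]) auto
    qed (use x in auto)
  qed (use periodic in auto)
  moreover have "card ((\<lambda>x. x + N) ` (S \<inter> {..<k})) = card (S \<inter> {..<k})"
    by (rule card_image) (simp add: inj_on_def)
  moreover have "S \<inter> {..<N} \<inter> (\<lambda>x. x + N) ` (S \<inter> {..<k}) = {}" by auto
  ultimately show ?thesis
    by (simp add: q_def card_Un_disjoint)
qed

lemma enumerate_shift: "enumerate S (x + q) = enumerate S x + N"
proof -
  have "enumerate S x + N \<in> S" using periodic enumerate_in_set[OF infinite_S] by simp
  then show ?thesis
    using enumerate_card_below[OF infinite_S, of "enumerate S x + N"]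
    by (simp add: card_below_shift card_below_enumerate[OF infinite_S])
qed

lemma q_pos: "0 < q"
  using enumerate_shift[of 0] N_pos by (cases q) auto

lemma enumerate_less_N_iff: "enumerate S x < N \<longleftrightarrow> x < q"
proof
  assume "x < q"
  show "enumerate S x < N"
  proof (rule ccontr)
    assume "\<not> ?thesis"
    then have "S \<inter> {..<N} \<subseteq> S \<inter> {..<enumerate S x}" by auto
    then have "q \<le> x"
      unfolding q_def by (subst card_below_enumerate[OF infinite_S, of x, symmetric]) (rule card_mono; simp)
    with \<open>x < q\<close> show False by simp
  qed
next
  assume *: "enumerate S x < N"
  show "x < q"
  proof (rule ccontr)
    assume "\<not> ?thesis"
    then have "enumerate S (0 + q) \<le> enumerate S x" using infinite_S by simp
    then show False using * by (simp only: enumerate_shift)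
  qed
qed

lemma gap_shift: "gap (x + q) = gap x"
  using enumerate_shift[of x] enumerate_shift[of "Suc x"] by (simp add: gap_def)

lemma gap_mod: "gap (x mod q) = gap x"
proof -
  have "gap (y + t * q) = gap y" for y t
  proof (induction t)
    case (Suc t)
    then show ?case using gap_shift[of "y + t * q"] by (simp add: algebra_simps)
  qed simp
  from this[of "x mod q" "x div q"] show ?thesis by (simp only: mod_div_mult_eq)
qed

lemma gap_q_1: "q = 1 \<Longrightarrow> gap x = N"
  using enumerate_shift[of x] by (simp add: gap_def)

text \<open>
  A set of natural numbers may start late, so a shift identity for its enumeration only gives
  the forward implication directly.  The converse comes from going on to the multiple \<open>N * M\<close> of
  the given period \<open>N\<close> and then back by that multiple.
\<close>

lemma period_if_enumerate_shift:
  assumes "\<And>x. enumerate S (x + r) = enumerate S x + M"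
  shows "k + M \<in> S \<longleftrightarrow> k \<in> S"
proof -
  have fwd: "k + t * M \<in> S" if "k \<in> S" for k t
  proof (induction t)
    case (Suc t)
    then obtain x where "enumerate S x = k + t * M" using enumerate_Ex[OF infinite_S] by blast
    then have "k + Suc t * M = enumerate S (x + r)" using assms[of x] by simp
    then show ?case using enumerate_in_set[OF infinite_S] by simp
  qed (use that in simp)
  have "k \<in> S" if "k + M \<in> S"
  proof -
    have "k + N * M = (k + M) + (N - 1) * M" using N_pos by (cases N) auto
    then show ?thesis using fwd[OF that, of "N - 1"] periodic_mult[of k M]
      by (simp add: mult.commute add.assoc)
  qed
  then show ?thesis using fwd[of k 1] by auto
qed

text \<open>
  Minimality of \<open>N\<close> makes the cyclic list of gaps primitive: a proper rotation that fixed it would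
  give the shorter period \<open>enumerate S r - enumerate S 0\<close> of \<open>S\<close>.
\<close>

lemma gap_primitive:
  assumes "0 < r" "r < q"
  shows "\<exists>x. gap (x + r) \<noteq> gap x"
proof (rule ccontr)
  assume "\<not> ?thesis"
  then have inv: "gap (x + r) = gap x" for x by blast
  define M where "M = enumerate S r - enumerate S 0"
  have less: "enumerate S 0 < enumerate S r" "enumerate S r < enumerate S q"
    using assms infinite_S by simp_all
  have "enumerate S (x + r) = enumerate S x + M" for x
  proof (induction x)
    case (Suc x)
    then show ?case using enumerate_Suc_gap[of x] enumerate_Suc_gap[of "x + r"] inv[of x] by simp
  qed (use less in \<open>simp add: M_def\<close>)
  then have "N \<le> M" using less by (intro minimal period_if_enumerate_shift) (simp_all add: M_def)
  then show False using less enumerate_shift[of 0] by (simp add: M_def)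
qed

section \<open>Floor sequences and the block criterion\<close>

text \<open>
  A floor sequence of slope \<open>n / q'\<close> advances by \<open>n\<close> after \<open>q'\<close> terms, and \<open>S\<close> advances by \<open>N\<close> after
  \<open>q\<close> terms; comparing \<open>q' q\<close> terms gives \<open>n q = N q'\<close>.  Coprimality and minimality of \<open>N\<close> then
  leave no freedom.
\<close>

lemma floor_form_params:
  assumes "coprime q' n" "0 < q'" "0 < n" and form: "\<And>x. enumerate S x = (n * x + e) div q'"
  shows "n = N" "q' = q"
proof -
  have shift: "enumerate S (x + q' * t) = enumerate S x + n * t" for x t
  proof -
    have eq: "n * (x + q' * t) + e = (n * x + e) + q' * (n * t)" by (simp add: algebra_simps)
    show ?thesis unfolding form eq using assms(2) by simp
  qed
  have "enumerate S (x + t * q) = enumerate S x + t * N" for x t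
  proof (induction t)
    case (Suc t)
    then show ?case using enumerate_shift[of "x + t * q"] by (simp add: algebra_simps)
  qed simp
  from shift[of 0 q] this[of 0 q'] have eq: "n * q = N * q'" by (simp add: mult.commute)
  then have "n dvd N * q'" by (metis dvd_triv_left)
  then have "n dvd N" using assms(1) by (simp add: coprime_commute coprime_dvd_mult_left_iff)
  then have "n \<le> N" using N_pos by (simp add: dvd_imp_le)
  moreover have "N \<le> n"
    using assms(3) shift[of _ 1] by (intro minimal period_if_enumerate_shift[of q']) simp_all
  ultimately show "n = N" by simp
  then show "q' = q" using eq N_pos by simp
qed

text \<open>
  Extending \<open>gap\<close> periodically to the integers replaces the cyclic list indices by congruences, so
  that the two rotation lemmas apply.
\<close>

lemma gap_int:
  defines "G \<equiv> \<lambda>y. gap (nat (y mod int q))"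
  shows "[x = y] (mod int q) \<Longrightarrow> G x = G y" and "G (int z) = gap z"
  by (simp_all add: G_def cong_def gap_mod flip: of_nat_mod)

lemma shift_is_adjacent_transposition_gaps:
  assumes "2 \<le> q"
  defines "G \<equiv> \<lambda>y. gap (nat (y mod int q))"
  shows "shift_is_adjacent_transposition (map gap [0..<q]) \<longleftrightarrow>
    (\<exists>r p. 0 < r \<and> r < q \<and> p < q \<and>
       (\<forall>x. G (x + int r) = G (if [x = int p] (mod int q) then int p + 1
                       else if [x = int p + 1] (mod int q) then int p else x)))"
proof -
  have *: "(\<forall>x<q. gap ((x + r) mod q) = gap (Transposition.transpose p (Suc p mod q) x)) \<longleftrightarrow>
    (\<forall>x. G (x + int r) = G (if [x = int p] (mod int q) then int p + 1
                       else if [x = int p + 1] (mod int q) then int p else x))"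
    (is "?L \<longleftrightarrow> (\<forall>x. ?R x)")
    if "p < q" for r p
  proof -
    have R: "?R (int x) \<longleftrightarrow> gap ((x + r) mod q) = gap (Transposition.transpose p (Suc p mod q) x)"
      if "x < q" for x
    proof -
      have "[int x = int p] (mod int q) \<longleftrightarrow> x = p"
        using that \<open>p < q\<close> by (simp add: cong_int_iff cong_def)
      moreover have "[int x = int p + 1] (mod int q) \<longleftrightarrow> x = Suc p mod q"
        using that cong_int_iff[of x "Suc p" q] by (simp add: cong_def add.commute)
      moreover have "G (int p + 1) = gap (Suc p mod q)" "G (int x + int r) = gap ((x + r) mod q)"
        "G (int x) = gap x" "G (int p) = gap p"
        using gap_int(2)[of "Suc p"] gap_int(2)[of "x + r"] gap_int(2)[of x] gap_int(2)[of p]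
        by (simp_all add: G_def gap_mod add.commute)
      ultimately show ?thesis by (simp add: Transposition.transpose_def)
    qed
    have "?R x" if "?R (x mod int q)" for x
    proof -
      have c: "[x mod int q = x] (mod int q)" by (simp add: cong_def)
      then have "[x mod int q = y] (mod int q) \<longleftrightarrow> [x = y] (mod int q)" for y
        by (simp add: cong_def)
      moreover have "G (x mod int q) = G x" "G (x mod int q + int r) = G (x + int r)"
        using gap_int(1) c cong_add[OF c cong_refl[of "int r"]] by (simp_all add: G_def)
      ultimately show ?thesis using that by (simp split: if_splits)
    qed
    moreover have "x mod int q = int (nat (x mod int q))" "nat (x mod int q) < q" for x
      using assms by (simp_all add: nat_less_iff)
    ultimately have "(\<forall>x. ?R x) \<longleftrightarrow> (\<forall>x<q. ?R (int x))" by metis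
    then show ?thesis using R by simp
  qed
  then show ?thesis
    unfolding shift_is_adjacent_transposition_map_upt[OF assms(1)]
    by (intro ex_cong1 conj_cong refl) (rule *)
qed

text \<open>
  Summing gaps \<open>B\<close> plus a carry reproduces a floor sequence of slope \<open>B + s / q\<close>.
\<close>

lemma floor_form_if_rotation_coding:
  fixes s c :: int and B :: nat
  assumes "0 \<le> s" "s < int q"
    and gap: "\<And>x. int (gap x) = int B + of_bool ((s * int x + c) mod int q < s)"
  shows "\<exists>e. \<forall>x. enumerate S x = ((B * q + nat s) * x + e) div q"
proof -
  \<comment> \<open>congruent to \<open>c - s\<close>, so that the carry into the next term is coded by \<open>c\<close>, and giving the right first term\<close>
  define e where "e = int (q * enumerate S 0) + (c - s) mod int q"
  have q: "0 < int q" using q_pos by simp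
  have e: "0 \<le> e" using q by (simp add: e_def)
  have "int (enumerate S x) = ((int B * int q + s) * int x + e) div int q" for x
  proof (induction x)
    case 0
    show ?case using q by (simp add: e_def)
  next
    case (Suc x)
    define u where "u = (int B * int q + s) * int x + e"
    have "[u + s = s * int x + c] (mod int q)"
    proof -
      have "u + s - (s * int x + c) = ((c - s) mod int q - (c - s)) + int q * (int B * int x + int (enumerate S 0))"
        by (simp add: u_def e_def algebra_simps)
      moreover have "int q dvd (c - s) mod int q - (c - s)" by (simp add: mod_eq_dvd_iff[symmetric])
      ultimately show ?thesis unfolding cong_iff_dvd_diff by (simp only: dvd_add dvd_triv_left)
    qed
    then have "int (gap x) = int B + of_bool ((u + s) mod int q < s)"
      by (simp add: gap cong_def)
    moreover have "(int B * int q + s) * int (Suc x) + e = u + (int B * int q + s)"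
      by (simp add: u_def algebra_simps)
    ultimately show ?case
      using Suc div_add_carry[OF assms(1,2), of u "int B"]
      by (simp add: enumerate_Suc_gap u_def[symmetric])
  qed
  then have "int (enumerate S x) = int (((B * q + nat s) * x + nat e) div q)" for x
    using assms(1) e by (simp add: zdiv_int)
  then have "enumerate S x = ((B * q + nat s) * x + nat e) div q" for x
    by (simp only: of_nat_eq_iff)
  then show ?thesis by blast
qed

lemma rotation_coding_if_floor_form:
  assumes "\<And>x. enumerate S x = (N * x + e) div q"
  shows "int (gap x) = int (N div q) +
    of_bool ((int (N mod q) * int x + (int e + int (N mod q))) mod int q < int (N mod q))"
proof -
  define u where "u = int (N * x + e)"
  have "N * Suc x + e = (N * x + e) + (N div q * q + N mod q)"
    unfolding div_mult_mod_eq by simp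
  then have "int (N * Suc x + e) = u + (int (N div q) * int q + int (N mod q))"
    unfolding u_def of_nat_mult[symmetric] of_nat_add[symmetric] of_nat_eq_iff .
  then have "int (enumerate S (Suc x)) = (u + (int (N div q) * int q + int (N mod q))) div int q"
    by (simp only: assms zdiv_int[of "N * Suc x + e"])
  also have "\<dots> = u div int q + int (N div q) + of_bool ((u + int (N mod q)) mod int q < int (N mod q))"
    using q_pos by (intro div_add_carry) simp_all
  also have "u div int q = int (enumerate S x)" by (simp add: assms u_def zdiv_int)
  finally have "int (gap x) = int (N div q) + of_bool ((u + int (N mod q)) mod int q < int (N mod q))"
    using enumerate_less[of x] by (simp add: gap_def of_nat_diff)
  moreover have "(u + int (N mod q)) mod int q =
      (int (N mod q) * int x + (int e + int (N mod q))) mod int q"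
  proof -
    have "[N * x + e + N mod q = (N mod q) * x + (e + N mod q)] (mod q)"
      unfolding add.assoc by (intro cong_add cong_mult) (simp_all add: cong_def)
    then have "[int (N * x + e + N mod q) = int ((N mod q) * x + (e + N mod q))] (mod int q)"
      by (simp only: cong_int_iff)
    then show ?thesis by (simp add: u_def cong_def)
  qed
  ultimately show ?thesis by simp
qed

lemma set_gaps: "set (map gap [0..<q]) = range gap"
proof -
  have "gap x \<in> gap ` {..<q}" for x
    using q_pos gap_mod[of x] by (metis imageI lessThan_iff mod_less_divisor)
  then show ?thesis by (auto simp: atLeast0LessThan)
qed

text \<open>
  Each gap is \<open>N div q\<close>, or one more where a carry occurs, and the carries form a rotation coding
  with \<open>s = N mod q\<close>.  Coprimality makes \<open>s\<close> invertible as soon as there are two gaps, so the list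
  has the transposition property; both lengths occur because the list is primitive.
\<close>

lemma block_pattern_if_floor_form:
  assumes "coprime q N" "q < N" "\<And>x. enumerate S x = (N * x + e) div q"
  shows "\<exists>b\<ge>2. b \<in> range gap \<and> range gap \<subseteq> {b, b - 1}"
    and "shift_is_adjacent_transposition (map gap [0..<q])"
proof -
  consider "q = 1" | "2 \<le> q" using q_pos by linarith
  then have "(\<exists>b\<ge>2. b \<in> range gap \<and> range gap \<subseteq> {b, b - 1}) \<and>
             shift_is_adjacent_transposition (map gap [0..<q])"
  proof cases
    case 1
    then have "gap = (\<lambda>x. N)" using gap_q_1 by blast
    moreover have "shift_is_adjacent_transposition (map gap [0..<q])"
      unfolding shift_is_adjacent_transposition_def
      by (rule exI[of _ 1], rule exI[of _ 0]) (simp add: 1 permute_list_def)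
    ultimately show ?thesis using assms(2) 1 by auto
  next
    case 2
    define s where "s = int (N mod q)"
    define c where "c = int e + s"
    define B where "B = N div q"
    define G where "G = (\<lambda>y. gap (nat (y mod int q)))"
    have "coprime (N mod q) q"
      using assms(1) q_pos by (subst coprime_mod_left_iff) (simp_all add: coprime_commute)
    then have "coprime s (int q)" by (simp only: s_def coprime_int_iff)
    have s: "0 < s" "s < int q"
    proof -
      have "s \<noteq> 0" using \<open>coprime s (int q)\<close> 2 by auto
      then show "0 < s" "s < int q" using q_pos by (auto simp: s_def)
    qed
    have gap: "int (gap x) = int B + of_bool ((s * int x + c) mod int q < s)" for x
      using rotation_coding_if_floor_form[OF assms(3)] by (simp add: s_def c_def B_def)
    have G: "int (G y) = int B + of_bool ((s * y + c) mod int q < s)" for y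
    proof -
      have "[s * (y mod int q) + c = s * y + c] (mod int q)"
        by (intro cong_add cong_mult) (simp_all add: cong_def)
      then show ?thesis using 2 by (simp add: G_def gap cong_def)
    qed
    have B: "1 \<le> B" using assms(2) q_pos by (simp add: B_def Suc_le_eq div_greater_zero_iff)
    have gap_cases: "gap x = B \<or> gap x = B + 1" for x
      using gap[of x] by (cases "(s * int x + c) mod int q < s") auto
    obtain x where "gap (x + 1) \<noteq> gap x" using gap_primitive[of 1] 2 by auto
    then have "B + 1 \<in> range gap" using gap_cases by (metis rangeI)
    then have "\<exists>b\<ge>2. b \<in> range gap \<and> range gap \<subseteq> {b, b - 1}"
      using B gap_cases by (intro exI[of _ "B + 1"]) auto
    moreover have "shift_is_adjacent_transposition (map gap [0..<q])"
    proof -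
      obtain r0 where r0: "[s * r0 = 1] (mod int q)"
        using cong_solve_coprime_int[OF \<open>coprime s (int q)\<close>] by blast
      define r where "r = nat (r0 mod int q)"
      \<comment> \<open>\<open>p\<close> is the place coded by \<open>q - 1\<close>, the point about to enter the arc\<close>
      define p where "p = nat ((r0 * (- 1 - c)) mod int q)"
      have r: "int r = r0 mod int q" and p: "int p = (r0 * (- 1 - c)) mod int q"
        using q_pos by (simp_all add: r_def p_def)
      have sr: "[s * int r = 1] (mod int q)"
        using r0 by (simp add: r cong_def mod_mult_right_eq)
      have "[s * int p + c = (s * r0) * (- 1 - c) + c] (mod int q)"
        unfolding p mult.assoc by (intro cong_add cong_mult) (simp_all add: cong_def)
      also have "[(s * r0) * (- 1 - c) + c = 1 * (- 1 - c) + c] (mod int q)"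
        using r0 by (intro cong_add cong_mult) simp_all
      finally have sp: "[s * int p + c = -1] (mod int q)" by simp
      have "0 < r"
      proof (rule ccontr)
        assume "\<not> 0 < r"
        then show False using sr 2 by (simp add: cong_def)
      qed
      moreover have "int r < int q" "int p < int q" unfolding r p using q_pos by simp_all
      then have "r < q" "p < q" by simp_all
      moreover have "G (x + int r) = G (if [x = int p] (mod int q) then int p + 1
                       else if [x = int p + 1] (mod int q) then int p else x)" for x
        unfolding of_nat_eq_iff[where 'a = int, symmetric] G rotation_coding_swap[OF s sr sp, of x] ..
      ultimately show ?thesis
        unfolding shift_is_adjacent_transposition_gaps[OF 2] G_def
        by blast
    qed
    ultimately show ?thesis by blast
  qed
  then show "\<exists>b\<ge>2. b \<in> range gap \<and> range gap \<subseteq> {b, b - 1}"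
    "shift_is_adjacent_transposition (map gap [0..<q])" by blast+
qed

text \<open>
  The exchanged gaps differ, for otherwise the list would be invariant under the shift.  Hence the
  gap sequence is a two-valued rotation coding.  If the longer gap is the one taken on the arc of
  length \<open>s\<close>, this is the claimed form; if it is the shorter one, reflecting \<open>\<int>/q\<close> turns the
  complementary arc of length \<open>q - s\<close> into an initial arc.
\<close>

lemma rotation_coding_if_shift_is_adjacent_transposition:
  assumes "2 \<le> q" "1 \<le> b" "range gap \<subseteq> {b, b - 1}"
    and "shift_is_adjacent_transposition (map gap [0..<q])"
  shows "\<exists>s c. 0 < s \<and> s < int q \<and> coprime s (int q) \<and>
    (\<forall>x. int (gap x) = int (b - 1) + of_bool ((s * int x + c) mod int q < s))"
proof -
  define G where "G = (\<lambda>y. gap (nat (y mod int q)))"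
  have per: "[x = y] (mod int q) \<Longrightarrow> G x = G y" and G: "G (int z) = gap z" for x y z
    using gap_int(1)[of x y] gap_int(2)[of z] by (simp_all add: G_def)
  obtain r p where rp: "0 < r" "r < q" "p < q" and
    swap: "\<And>x. G (x + int r) = G (if [x = int p] (mod int q) then int p + 1
                       else if [x = int p + 1] (mod int q) then int p else x)"
    using assms(4) unfolding shift_is_adjacent_transposition_gaps[OF assms(1)] G_def by blast
  have ne: "G (int p) \<noteq> G (int p + 1)"
  proof
    assume eq: "G (int p) = G (int p + 1)"
    have "G (x + int r) = G x" for x
      using swap[of x] eq per[of x "int p"] per[of x "int p + 1"] by (auto split: if_splits)
    then have "gap (x + r) = gap x" for x
      using G[of "x + r"] G[of x] by simp
    then show False using gap_primitive[OF rp(1,2)] by blast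
  qed
  obtain s where s: "0 < s" "s < int q" "[s * int r = 1] (mod int q)" and
    coding: "\<And>x. G x = (if (s * (x - int p) - 1) mod int q < s then G (int p + 1) else G (int p))"
    using swap_imp_rotation_coding[of "int q" G, OF _ per swap ne] assms(1) by auto
  have cop: "coprime s (int q)"
    using s(3) coprime_iff_invertible_int by blast
  have "G y \<in> {b, b - 1}" for y using assms(3) by (auto simp: G_def)
  then consider "G (int p + 1) = b" "G (int p) = b - 1" | "G (int p + 1) = b - 1" "G (int p) = b"
    using ne by (metis insert_iff singletonD)
  then show ?thesis
  proof cases
    case 1
    have "int (gap x) = int (b - 1) + of_bool ((s * int x + (- s * int p - 1)) mod int q < s)" for x
    proof -
      have eq: "s * int x + (- s * int p - 1) = s * (int x - int p) - 1" by (simp add: algebra_simps)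
      have "gap x = (if (s * (int x - int p) - 1) mod int q < s then b else b - 1)"
        using coding[of "int x"] unfolding G[of x] 1 .
      then show ?thesis using assms(2) unfolding eq
        by (cases "(s * (int x - int p) - 1) mod int q < s") simp_all
    qed
    then show ?thesis using s cop by blast
  next
    case 2
    have "int (gap x) = int (b - 1) +
      of_bool (((int q - s) * int x + s * int p) mod int q < int q - s)" for x
    proof -
      define w where "w = (s * (int x - int p) - 1) mod int q"
      have w: "0 \<le> w" "w < int q" using q_pos by (simp_all add: w_def)
      have "[(int q - s) * int x + s * int p = - 1 - (s * (int x - int p) - 1)] (mod int q)"
      proof -
        have "(int q - s) * int x + s * int p - (- 1 - (s * (int x - int p) - 1)) = int q * int x"
          by (simp add: algebra_simps)
        then show ?thesis by (simp add: cong_iff_dvd_diff)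
      qed
      also have "[- 1 - (s * (int x - int p) - 1) = - 1 - w] (mod int q)"
        by (intro cong_diff) (simp_all add: w_def cong_def)
      also have "[- 1 - w = int q - 1 - w] (mod int q)"
        by (simp add: cong_iff_dvd_diff)
      finally have "((int q - s) * int x + s * int p) mod int q = int q - 1 - w"
        using w by (simp add: cong_def)
      moreover have "gap x = (if w < s then b - 1 else b)"
        using coding[of "int x"] unfolding G[of x] 2 w_def .
      ultimately show ?thesis using assms(2) by (cases "w < s") simp_all
    qed
    moreover have "coprime (int q - s) (int q)"
      using cop by (metis coprime_diff_one_left_nat coprime_commute gcd_diff1 gcd_diff2 coprime_iff_gcd_eq_1)
    moreover have "0 < int q - s" "int q - s < int q" using s by simp_all
    ultimately show ?thesis by blast
  qed
qed

text \<open>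
  The slope is \<open>n / q\<close> with \<open>n = (b - 1) q + s\<close>.  The condition \<open>b \<ge> 2\<close> is what makes \<open>q < n\<close>, and
  \<open>e < n\<close> holds because the last of the \<open>q\<close> elements in the first period still lies below \<open>N = n\<close>.
\<close>

lemma floor_form_if_block_pattern:
  assumes "2 \<le> b" "b \<in> range gap" "range gap \<subseteq> {b, b - 1}"
    and "shift_is_adjacent_transposition (map gap [0..<q])"
  shows "\<exists>q' n e. 0 < q' \<and> q' < n \<and> coprime q' n \<and> e < n \<and>
    (\<forall>x. enumerate S x = (n * x + e) div q')"
proof -
  consider "q = 1" | "2 \<le> q" using q_pos by linarith
  then show ?thesis
  proof cases
    case 1
    have "enumerate S x = (N * x + enumerate S 0) div 1" for x
    proof (induction x)
      case (Suc x)
      then show ?case using enumerate_shift[of x] 1 by simp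
    qed simp
    moreover have "enumerate S 0 < N" using enumerate_less_N_iff q_pos by simp
    moreover have "1 < N" using gap_q_1[OF 1] assms(1,2) by auto
    ultimately show ?thesis by (metis coprime_1_left zero_less_one)
  next
    case 2
    obtain s c where s: "0 < s" "s < int q" and cop: "coprime s (int q)" and
      gap: "\<And>x. int (gap x) = int (b - 1) + of_bool ((s * int x + c) mod int q < s)"
      using rotation_coding_if_shift_is_adjacent_transposition[OF 2 _ assms(3,4)] assms(1) by auto
    define n where "n = (b - 1) * q + nat s"
    obtain e where e: "\<And>x. enumerate S x = (n * x + e) div q"
      using floor_form_if_rotation_coding[OF _ s(2) gap] s(1) unfolding n_def by auto
    have "coprime (nat s) q"
      using cop s by (metis coprime_int_iff int_nat_eq less_le)
    then have "coprime q n"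
      unfolding n_def coprime_iff_gcd_eq_1 gcd_add_mult by (simp only: gcd.commute)
    moreover have "q < n"
    proof -
      have "1 * q \<le> (b - 1) * q" using assms(1) by (intro mult_le_mono1) simp
      moreover have "0 < nat s" using s by simp
      ultimately show ?thesis unfolding n_def by linarith
    qed
    moreover have "e < n"
    proof -
      have "n = N" using floor_form_params(1)[OF \<open>coprime q n\<close> q_pos _ e] \<open>q < n\<close> by simp
      then have "(n * (q - 1) + e) div q < n"
        using enumerate_less_N_iff[of "q - 1"] q_pos e by simp
      then have "n * (q - 1) + e < n * q" using q_pos by (simp add: div_less_iff_less_mult)
      then show ?thesis using q_pos by (cases q) simp_all
    qed
    ultimately show ?thesis using q_pos e by blast
  qed
qed

theorem floor_form_iff_block_pattern:
  "(\<exists>q' n e. 0 < q' \<and> q' < n \<and> coprime q' n \<and> e < n \<and>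
      (\<forall>x. enumerate S x = (n * x + e) div q')) \<longleftrightarrow>
   (\<exists>b\<ge>2. b \<in> set (map gap [0..<q]) \<and> set (map gap [0..<q]) \<subseteq> {b, b - 1}) \<and>
   shift_is_adjacent_transposition (map gap [0..<q])" (is "?L \<longleftrightarrow> ?R")
proof
  assume ?L
  then obtain q' n e where *: "0 < q'" "q' < n" "coprime q' n" "\<And>x. enumerate S x = (n * x + e) div q'"
    by blast
  then have "n = N" "q' = q" using floor_form_params[OF *(3,1) _ *(4)] by auto
  then show ?R
    using block_pattern_if_floor_form[of e] * by (simp only: set_gaps)
next
  assume ?R
  then show ?L unfolding set_gaps using floor_form_if_block_pattern by blast
qed

end

section \<open>Blocks of a digit string\<close>

definition breaks :: "int \<Rightarrow> int \<Rightarrow> (nat \<Rightarrow> int) \<Rightarrow> nat set" where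
  "breaks m i d = {k. \<not> [d (Suc k) = d k + i] (mod m)}"

lemma in_breaks_iff_increment: "k \<in> breaks m i d \<longleftrightarrow> \<not> [increment m d k = i] (mod m)"
proof -
  have "[d (Suc k) = d k + i] (mod m) \<longleftrightarrow> [d (Suc k) - d k = i] (mod m)"
    by (simp add: cong_iff_dvd_diff algebra_simps)
  then show ?thesis by (simp add: breaks_def increment_def cong_def)
qed

lemma is_block_iff_consecutive_breaks:
  assumes "infinite (breaks m i d)"
  defines "P \<equiv> enumerate (breaks m i d)"
  shows "is_block m i d s l \<longleftrightarrow> (\<exists>x. s = Suc (P x) \<and> l = P (Suc x) - P x)"
proof -
  have less: "P x < P (Suc x)" for x using assms(1) by (simp add: P_def)
  have block: "is_block m i d s l \<longleftrightarrow> 0 < s \<and> 0 < l \<and> s - 1 \<in> breaks m i d \<and>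
      s + l - 1 \<in> breaks m i d \<and> (\<forall>k. s \<le> k \<and> k < s + l - 1 \<longrightarrow> k \<notin> breaks m i d)"
  proof -
    have "(\<forall>k. s < k \<and> k < s + l \<longrightarrow> [d k = d (k - 1) + i] (mod m)) \<longleftrightarrow>
          (\<forall>k. s \<le> k \<and> k < s + l - 1 \<longrightarrow> k \<notin> breaks m i d)" if "0 < s" "0 < l"
    proof (intro iffI allI impI)
      fix k assume *: "\<forall>k. s < k \<and> k < s + l \<longrightarrow> [d k = d (k - 1) + i] (mod m)"
        and k: "s \<le> k \<and> k < s + l - 1"
      show "k \<notin> breaks m i d" using *[rule_format, of "Suc k"] k by (simp add: breaks_def less_diff_conv)
    next
      fix k assume *: "\<forall>k. s \<le> k \<and> k < s + l - 1 \<longrightarrow> k \<notin> breaks m i d" and k: "s < k \<and> k < s + l"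
      then obtain k' where "k = Suc k'" by (cases k) auto
      then show "[d k = d (k - 1) + i] (mod m)"
        using *[rule_format, of k'] k by (simp add: breaks_def less_diff_conv)
    qed
    then show ?thesis by (auto simp: is_block_def breaks_def)
  qed
  show ?thesis
  proof
    assume "is_block m i d s l"
    then have b: "0 < s" "0 < l" "s - 1 \<in> breaks m i d" "s + l - 1 \<in> breaks m i d"
      "\<And>k. s \<le> k \<Longrightarrow> k < s + l - 1 \<Longrightarrow> k \<notin> breaks m i d"
      unfolding block by blast+
    obtain x y where x: "P x = s - 1" and y: "P y = s + l - 1"
      using enumerate_Ex[OF assms(1)] b(3,4) unfolding P_def by blast
    have "P x < P y" using x y b(1,2) by simp
    then have "Suc x \<le> y" using assms(1) by (simp add: P_def Suc_le_eq)
    then have "P (Suc x) \<le> P y" using assms(1) by (simp add: P_def)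
    moreover have "P (Suc x) \<in> breaks m i d" using enumerate_in_set[OF assms(1)] by (simp add: P_def)
    then have "\<not> P (Suc x) < s + l - 1" using b(5)[of "P (Suc x)"] less[of x] x by linarith
    ultimately have "P (Suc x) = s + l - 1" using y by simp
    then show "\<exists>x. s = Suc (P x) \<and> l = P (Suc x) - P x"
      using x b(1,2) by (intro exI[of _ x]) auto
  next
    assume "\<exists>x. s = Suc (P x) \<and> l = P (Suc x) - P x"
    then obtain x where x: "s = Suc (P x)" "l = P (Suc x) - P x" by blast
    have "k \<notin> breaks m i d" if "s \<le> k" "k < P (Suc x)" for k
    proof
      assume "k \<in> breaks m i d"
      then obtain y where "P y = k" using enumerate_Ex[OF assms(1)] unfolding P_def by blast
      then show False using that x assms(1) by (auto simp: P_def Suc_le_eq)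
    qed
    moreover have "P x \<in> breaks m i d" "P (Suc x) \<in> breaks m i d"
      using enumerate_in_set[OF assms(1)] by (simp_all add: P_def)
    ultimately show "is_block m i d s l"
      unfolding block using x less[of x] by simp
  qed
qed

text \<open>
  Block starts are the successors of breaks.  Those in \<open>{1..N}\<close> come from the breaks below the
  period \<open>N\<close>, that is, from the first \<open>q\<close> of them.
\<close>

lemma block_lengths_eq_gaps:
  assumes "primitive_periodic_set (breaks m i d) (increment_period m d)"
  shows "block_lengths m i d =
    map (primitive_periodic_set.gap (breaks m i d))
      [0..<primitive_periodic_set.q (breaks m i d) (increment_period m d)]"
proof -
  interpret primitive_periodic_set "breaks m i d" "increment_period m d" by fact
  let ?P = "enumerate (breaks m i d)" and ?N = "increment_period m d"
  note block = is_block_iff_consecutive_breaks[OF infinite_S]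
  have "{s \<in> {1..?N}. \<exists>l. is_block m i d s l} = set (map (\<lambda>x. Suc (?P x)) [0..<q])"
  proof (rule set_eqI)
    fix s
    have "s \<in> {s \<in> {1..?N}. \<exists>l. is_block m i d s l} \<longleftrightarrow> (\<exists>x. s = Suc (?P x) \<and> ?P x < ?N)"
      unfolding block by force
    also have "\<dots> \<longleftrightarrow> s \<in> set (map (\<lambda>x. Suc (?P x)) [0..<q])"
      unfolding enumerate_less_N_iff by auto
    finally show "s \<in> {s \<in> {1..?N}. \<exists>l. is_block m i d s l} \<longleftrightarrow>
      s \<in> set (map (\<lambda>x. Suc (?P x)) [0..<q])" .
  qed
  moreover have "sorted_wrt (<) (map (\<lambda>x. Suc (?P x)) [0..<q])"
    using infinite_S by (simp add: sorted_wrt_map sorted_wrt_iff_nth_less)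
  then have "sorted_list_of_set (set (map (\<lambda>x. Suc (?P x)) [0..<q])) = map (\<lambda>x. Suc (?P x)) [0..<q]"
    unfolding strict_sorted_iff by (intro sorted_list_of_set.idem_if_sorted_distinct) auto
  moreover have "(THE l. is_block m i d (Suc (?P x)) l) = gap x" for x
    using inj_eq[OF inj_enumerate[OF infinite_S]]
    by (intro the_equality) (auto simp: block gap_def)
  ultimately show ?thesis by (simp add: block_lengths_def)
qed

lemma block_lengths_empty:
  assumes "breaks m i d = {}"
  shows "block_lengths m i d = []"
proof -
  have "\<not> is_block m i d s l" for s l
    using assms by (auto simp: is_block_def breaks_def dest: spec[of _ "s - 1"])
  then show ?thesis by (simp add: block_lengths_def)
qed

text \<open>
  For an admissible string the breaks determine all increments, so that the increments and the set
  of breaks have the same periods.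
\<close>

lemma primitive_periodic_breaks:
  assumes "periodic d" "admissible_increments m i j d" "breaks m i d \<noteq> {}"
  shows "primitive_periodic_set (breaks m i d) (increment_period m d)"
proof -
  let ?N = "increment_period m d"
  obtain P where P: "0 < P" "\<And>k. d (k + P) = d k" using assms(1) by (auto simp: periodic_def)
  have "d (Suc (k + P)) = d (Suc k)" for k using P(2)[of "Suc k"] by simp
  then have "\<exists>N>0. \<forall>k. increment m d (k + N) = increment m d k"
    using P by (intro exI[of _ P]) (simp add: increment_def)
  then have N: "0 < ?N" "\<forall>k. increment m d (k + ?N) = increment m d k"
    unfolding increment_period_def by (rule LeastI2_ex; blast)+
  show ?thesis
  proof
    show "k + ?N \<in> breaks m i d \<longleftrightarrow> k \<in> breaks m i d" for k
      using N(2) by (simp add: in_breaks_iff_increment)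
    show "?N \<le> M" if M: "0 < M" "\<And>k. k + M \<in> breaks m i d \<longleftrightarrow> k \<in> breaks m i d" for M
    proof -
      have incr: "increment m d k = (if k \<in> breaks m i d then j mod m else i mod m)" for k
        using assms(2)
        by (auto simp: in_breaks_iff_increment admissible_increments_def increment_def cong_def)
      have "increment m d (k + M) = increment m d k" for k
        unfolding incr[of "k + M"] incr[of k] M(2) ..
      then show ?thesis unfolding increment_period_def using M(1) by (intro Least_le) simp
    qed
  qed (use N assms in auto)
qed

section \<open>Orbits and their crossings\<close>

text \<open>
  Inverting a floor sequence: \<open>(f + k q) div n\<close> jumps at \<open>k\<close> exactly when a multiple
  \<open>n (x + 1)\<close> lies in the half-open interval from \<open>f + k q\<close> (excluded) to \<open>f + (k + 1) q\<close>
  (included), and solving this for \<open>k\<close> gives \<open>k = (n x + e) div q\<close> with \<open>e = n - 1 - f\<close>.  So jump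
  times of slope \<open>q / n\<close> form a floor sequence of slope \<open>n / q\<close>.
\<close>

lemma floor_step:
  fixes f e n q k :: nat
  assumes "f + Suc e = n" "0 < q" "q \<le> n"
  shows "(f + Suc k * q) div n = (f + k * q) div n + of_bool (k \<in> range (\<lambda>x. (n * x + e) div q))"
proof -
  define u where "u = f + k * q"
  define t where "t = u div n"
  define \<rho> where "\<rho> = u mod n"
  have n: "0 < n" using assms by simp
  have u: "u = t * n + \<rho>" and \<rho>: "\<rho> < n" using n by (simp_all add: t_def \<rho>_def)
  have hit: "k = (n * x + e) div q \<longleftrightarrow> u < n * Suc x \<and> n * Suc x \<le> u + q" for x
  proof -
    have "k = (n * x + e) div q \<longleftrightarrow> k * q \<le> n * x + e \<and> n * x + e < Suc k * q"
      using assms(2) by (metis div_nat_eqI dividend_less_div_times div_times_less_eq_dividend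
          mult.commute mult_Suc add.commute)
    moreover have "n * Suc x = n * x + f + Suc e" using assms(1) by simp
    then have "k * q \<le> n * x + e \<longleftrightarrow> u < n * Suc x" "n * x + e < Suc k * q \<longleftrightarrow> n * Suc x \<le> u + q"
      by (simp_all only: u_def mult_Suc) linarith+
    ultimately show ?thesis by simp
  qed
  show ?thesis
  proof (cases "n \<le> \<rho> + q")
    case True
    have "k = (n * t + e) div q" unfolding hit using True u \<rho> by (simp add: algebra_simps)
    moreover have "(u + q) div n = t + 1"
      by (rule div_nat_eqI) (use True u \<rho> assms in \<open>simp_all add: algebra_simps\<close>)
    ultimately show ?thesis by (auto simp: u_def t_def algebra_simps)
  next
    case False
    have "\<not> (u < n * Suc x \<and> n * Suc x \<le> u + q)" for x
    proof
      assume *: "u < n * Suc x \<and> n * Suc x \<le> u + q"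
      have "n * t < n * Suc x" using * u by (simp add: mult.commute)
      then have "t < Suc x" using n by (simp only: mult_less_cancel1)
      moreover have "n * Suc x < n * Suc t" using * u False
        by (simp only: mult_Suc_right mult.commute) linarith
      then have "Suc x < Suc t" using n by (simp only: mult_less_cancel1)
      ultimately show False by simp
    qed
    then have "k \<notin> range (\<lambda>x. (n * x + e) div q)" using hit by auto
    moreover have "(u + q) div n = t"
      by (rule div_nat_eqI) (use False u in \<open>simp_all add: algebra_simps\<close>)
    ultimately show ?thesis by (simp add: u_def t_def algebra_simps)
  qed
qed

lemma crossing_eq_div:
  assumes "\<lfloor>real n * a\<rfloor> = int f" "0 < n"
  shows "crossing a q n k = int ((f + k * q) div n)"
proof -
  have "a + real k * real q / real n = (real n * a + real_of_int (int (k * q))) / real_of_int (int n)"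
    using assms(2) by (simp add: field_simps)
  then have "crossing a q n k = \<lfloor>real n * a + real_of_int (int (k * q))\<rfloor> div int n"
    unfolding crossing_def using floor_divide_real_eq_div[of "int n"] by simp
  also have "\<lfloor>real n * a + real_of_int (int (k * q))\<rfloor> = int (f + k * q)"
    using assms(1) by (simp only: floor_add_int[symmetric] of_nat_add)
  finally show ?thesis by (simp add: zdiv_int)
qed

text \<open>
  The coordinates of every point of the starting edge add up to \<open>1\<close> and those of the direction add
  up to \<open>1\<close> as well, so the ray can meet the lattice only at integer times \<open>t\<close>; there the first
  coordinate \<open>a + t q / n\<close> would be an integer, and with it \<open>n a\<close>.
\<close>

lemma ray_avoids_vertex_lattice:
  fixes v1 v2 :: "real^2"
  assumes "v1 \<noteq> v2" "independent {v1, v2}" "0 < n" "real n * a \<notin> \<int>"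
  shows "ray (start_point v1 v2 a) (direction v1 v2 q n) \<inter> vertex_lattice v1 v2 = {}"
proof (rule ccontr)
  assume "\<not> ?thesis"
  then obtain t x y where
    eq: "start_point v1 v2 a + t *\<^sub>R direction v1 v2 q n = real_of_int x *\<^sub>R v1 + real_of_int y *\<^sub>R v2"
    unfolding ray_def vertex_lattice_def by blast
  define \<alpha> where "\<alpha> = a + t * real q / real n - real_of_int x"
  define \<beta> where "\<beta> = 1 - a + t * (real n - real q) / real n - real_of_int y"
  have "\<alpha> *\<^sub>R v1 + \<beta> *\<^sub>R v2 =
    (start_point v1 v2 a + t *\<^sub>R direction v1 v2 q n) - (real_of_int x *\<^sub>R v1 + real_of_int y *\<^sub>R v2)"
    unfolding \<alpha>_def \<beta>_def start_point_def direction_def vec_eq_iff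
    using assms(3) by (simp add: field_simps)
  then have "\<alpha> *\<^sub>R v1 + \<beta> *\<^sub>R v2 = 0" using eq by simp
  then have "(\<Sum>v\<in>{v1, v2}. (if v = v1 then \<alpha> else \<beta>) *\<^sub>R v) = 0" using assms(1) by simp
  then have "(if v = v1 then \<alpha> else \<beta>) = 0" if "v \<in> {v1, v2}" for v
    using independentD[OF assms(2) _ subset_refl, where u = "\<lambda>v. if v = v1 then \<alpha> else \<beta>"] that
    by blast
  from this[of v1] this[of v2] have "\<alpha> = 0" "\<beta> = 0" using assms(1) by auto
  moreover have "\<alpha> + \<beta> = 1 + t - real_of_int (x + y)"
    using assms(3) by (simp add: \<alpha>_def \<beta>_def field_simps)
  ultimately have t: "t = real_of_int (x + y - 1)" by simp
  have "real n * a = real_of_int (int n * x - (x + y - 1) * int q)"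
    using \<open>\<alpha> = 0\<close> assms(3) unfolding \<alpha>_def t by (simp add: field_simps)
  then show False using assms(4) Ints_of_int by metis
qed

text \<open>
  Only \<open>f = \<lfloor>n a\<rfloor>\<close> matters for the digits of an orbit, and a digit increment is \<open>j\<close> exactly when the
  crossing number jumps.  Conversely, every \<open>f < n\<close> is realised by the midpoint
  \<open>a = (f + 1/2) / n\<close>, which is nonsingular because \<open>n a\<close> is not an integer.
\<close>

lemma encodes_orbit_iff_breaks_floor_form:
  fixes v1 v2 :: "real^2"
  assumes "v1 \<noteq> v2" "independent {v1, v2}" "\<not> [i = j] (mod m)" "d 0 = 0"
  shows "encodes_orbit v1 v2 m i j d \<longleftrightarrow> admissible_increments m i j d \<and>
    (\<exists>q n e. 0 < q \<and> q < n \<and> coprime q n \<and> e < n \<and>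
       breaks m i d = range (\<lambda>x. (n * x + e) div q))" (is "?L \<longleftrightarrow> ?R")
proof
  assume ?L
  then obtain q n a where q: "0 < q" "q < n" "coprime q n" and a: "0 < a" "a < 1" and
    d: "\<And>k. [d k = j * crossing a q n k + i * (int k - crossing a q n k)] (mod m)"
    unfolding encodes_orbit_def by blast
  define f where "f = nat \<lfloor>real n * a\<rfloor>"
  have n: "0 < n" using q by simp
  have f: "\<lfloor>real n * a\<rfloor> = int f" using a n by (simp add: f_def)
  have "real n * a < real n" using a n by simp
  then have "f < n" using f by linarith
  define e where "e = n - Suc f"
  have e: "f + Suc e = n" "e < n" using \<open>f < n\<close> by (simp_all add: e_def)
  define B where "B = range (\<lambda>x. (n * x + e) div q)"
  have step: "crossing a q n (Suc k) = crossing a q n k + of_bool (k \<in> B)" for k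
    unfolding crossing_eq_div[OF f n] floor_step[OF e(1) q(1) less_imp_le[OF q(2)]] B_def by simp
  have incr: "[d (Suc k) - d k = (if k \<in> B then j else i)] (mod m)" for k
  proof -
    have "[d (Suc k) - d k =
        (j * crossing a q n (Suc k) + i * (int (Suc k) - crossing a q n (Suc k))) -
        (j * crossing a q n k + i * (int k - crossing a q n k))] (mod m)"
      by (intro cong_diff d)
    also have "(j * crossing a q n (Suc k) + i * (int (Suc k) - crossing a q n (Suc k))) -
        (j * crossing a q n k + i * (int k - crossing a q n k)) = (if k \<in> B then j else i)"
      by (simp add: step algebra_simps)
    finally show ?thesis .
  qed
  have increment: "[increment m d k = (if k \<in> B then j else i)] (mod m)" for k
    using incr[of k] by (simp add: increment_def cong_def)
  have "k \<in> breaks m i d \<longleftrightarrow> k \<in> B" for k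
    using increment[of k] assms(3) unfolding in_breaks_iff_increment
    by (auto simp: cong_def split: if_splits)
  then have "breaks m i d = B" by blast
  moreover have "admissible_increments m i j d"
    using increment unfolding admissible_increments_def by metis
  ultimately show ?R using q e unfolding B_def by blast
next
  assume ?R
  then obtain q n e where adm: "admissible_increments m i j d" and
    q: "0 < q" "q < n" "coprime q n" and "e < n"
    and B: "breaks m i d = range (\<lambda>x. (n * x + e) div q)" by blast
  define f where "f = n - Suc e"
  have f: "f + Suc e = n" using \<open>e < n\<close> by (simp add: f_def)
  have n: "0 < n" using q by simp
  define a where "a = (real f + 1 / 2) / real n"
  have na: "real n * a = real f + 1 / 2" using n by (simp add: a_def)
  have fl: "\<lfloor>real n * a\<rfloor> = int f" unfolding na by linarith
  have "real n * a \<notin> \<int>"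
  proof
    assume "real n * a \<in> \<int>"
    then have "of_int \<lfloor>real n * a\<rfloor> = real n * a" by simp
    then show False unfolding fl na by simp
  qed
  then have "ray (start_point v1 v2 a) (direction v1 v2 q n) \<inter> vertex_lattice v1 v2 = {}"
    using assms(1,2) n by (intro ray_avoids_vertex_lattice)
  moreover have "0 < a" "a < 1"
    using f n by (simp_all add: a_def field_simps)
  moreover have "[d k = j * crossing a q n k + i * (int k - crossing a q n k)] (mod m)" for k
  proof (induction k)
    case 0
    have "f < n" using f by simp
    then show ?case using assms(4) by (simp add: crossing_eq_div[OF fl n])
  next
    case (Suc k)
    have step: "crossing a q n (Suc k) = crossing a q n k + of_bool (k \<in> breaks m i d)"
      unfolding crossing_eq_div[OF fl n] floor_step[OF f q(1) less_imp_le[OF q(2)]] B by simp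
    have "[increment m d k = (if k \<in> breaks m i d then j else i)] (mod m)"
      using adm by (auto simp: admissible_increments_def in_breaks_iff_increment)
    then have "[d (Suc k) - d k = (if k \<in> breaks m i d then j else i)] (mod m)"
      by (simp add: increment_def cong_def)
    then have "[(d (Suc k) - d k) + d k = (if k \<in> breaks m i d then j else i) +
        (j * crossing a q n k + i * (int k - crossing a q n k))] (mod m)"
      using Suc by (intro cong_add)
    also have "(if k \<in> breaks m i d then j else i) +
        (j * crossing a q n k + i * (int k - crossing a q n k)) =
        j * crossing a q n (Suc k) + i * (int (Suc k) - crossing a q n (Suc k))"
      by (simp add: step algebra_simps)
    finally show ?case by simp
  qed
  ultimately show ?L unfolding encodes_orbit_def using q by blast
qed

text \<open>
  As \<open>q < n\<close>, the floor sequence is strictly increasing and hence enumerates its own range.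
\<close>

lemma eq_range_floor_iff_enumerate:
  fixes q n e :: nat
  assumes "infinite S" "0 < q" "q < n"
  shows "S = range (\<lambda>x. (n * x + e) div q) \<longleftrightarrow> (\<forall>x. enumerate S x = (n * x + e) div q)"
proof
  assume "S = range (\<lambda>x. (n * x + e) div q)"
  moreover have "strict_mono (\<lambda>x. (n * x + e) div q)"
    unfolding strict_mono_Suc_iff
  proof
    fix x
    have "(n * x + e) div q < (n * x + e + q) div q" using assms(2) by simp
    also have "\<dots> \<le> (n * Suc x + e) div q" using assms(3) by (intro div_le_mono) simp
    finally show "(n * x + e) div q < (n * Suc x + e) div q" .
  qed
  ultimately show "\<forall>x. enumerate S x = (n * x + e) div q"
    using enumerate_range_strict_mono by metis
next
  assume "\<forall>x. enumerate S x = (n * x + e) div q"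
  then have "enumerate S = (\<lambda>x. (n * x + e) div q)" by blast
  then show "S = range (\<lambda>x. (n * x + e) div q)" using range_enumerate[OF assms(1)] by simp
qed

theorem theorem4p3:
  fixes v1 v2 :: "real^2" and m i j :: int and d :: "nat \<Rightarrow> int"
  assumes "v1 \<noteq> v2" and "independent {v1, v2}"
    and "(m, i, j) \<in> {(3, 1, -1), (2, 1, 0), (2, 0, 1)}"
    and "\<forall>k. d k \<in> {0..m - 1}"
    and "periodic d"
    and "d 0 = 0"
  shows "encodes_orbit v1 v2 m i j d \<longleftrightarrow>
    two_length_block_pattern m i j d \<and>
    shift_is_adjacent_transposition (block_lengths m i d)"
proof -
  have "\<not> [i = j] (mod m)" using assms(3) by (auto simp: cong_def)
  note encodes = encodes_orbit_iff_breaks_floor_form[where d = d and m = m and i = i and j = j, OF assms(1,2) this assms(6)]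
  consider "\<not> admissible_increments m i j d" | "breaks m i d = {}"
    | "admissible_increments m i j d" "breaks m i d \<noteq> {}" by blast
  then show ?thesis
  proof cases
    case 1
    then show ?thesis by (simp add: encodes two_length_block_pattern_def)
  next
    case 2
    then show ?thesis by (simp add: encodes two_length_block_pattern_def block_lengths_empty)
  next
    case 3
    interpret primitive_periodic_set "breaks m i d" "increment_period m d"
      using primitive_periodic_breaks[OF assms(5) 3] .
    have "encodes_orbit v1 v2 m i j d \<longleftrightarrow> (\<exists>q' n e. 0 < q' \<and> q' < n \<and> coprime q' n \<and> e < n \<and>
        (\<forall>x. enumerate (breaks m i d) x = (n * x + e) div q'))"
      unfolding encodes using 3(1) eq_range_floor_iff_enumerate[OF infinite_S] by blast
    also have "\<dots> \<longleftrightarrow> two_length_block_pattern m i j d \<and>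
        shift_is_adjacent_transposition (block_lengths m i d)"
      unfolding floor_form_iff_block_pattern two_length_block_pattern_def
        block_lengths_eq_gaps[OF primitive_periodic_set_axioms] using 3(1) by blast
    finally show ?thesis .
  qed
qed

end
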